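(* For every non-negative integer $n$, $\tau(1,n)=2n$.
   Context: $[E]^k$ is the set of $k$-element subsets of $E$; for $f:[E]^p\to\mathbb K$, $g:[E]^q\to\mathbb K$, $(fg)(Q)=\sum_{P\in[Q]^p}f(P)g(Q\setminus P)$ for $Q\in[E]^{p+q}$; $\mathrm{supp}(f)=\{P:f(P)\neq0\}$. A transversal of a family $\mathcal H$ of subsets of $E$ is a set meeting every member of $\mathcal H$; $\tau(\mathcal H)$ is the least cardinality of a transversal ($\tau(\emptyset)=0$). For non-negative integers $p,q$, $\tau(p,q)$ is the least integer $t$ such that for every set $E$ with at least $p+q$ elements, every field $\mathbb K$ of characteristic zero and all $f:[E]^p\to\mathbb K$, $g:[E]^q\to\mathbb K$ with $fg=0$, $f\neq0$, $g\neq0$, one has $\tau(\mathrm{supp}(f)\cup\mathrm{supp}(g))\le t$. *)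

theory Defs
  imports "HOL-Library.Ramsey" "HOL-Library.Extended_Nat" "HOL-Algebra.Ring"
begin

text \<open>
  The set \<open>[E]\<^bsup>k\<^esup>\<close> is the library's \<^const>\<open>nsets\<close>. A map \<open>[E]\<^bsup>k\<^esup> \<rightarrow> K\<close> is a function on all of
  \<^typ>\<open>'a set\<close> whose values are only constrained, and only ever inspected, on \<open>[E]\<^bsup>k\<^esup>\<close>.
\<close>

definition kprod ::
  "('k, 'm) ring_scheme \<Rightarrow> nat \<Rightarrow> ('a set \<Rightarrow> 'k) \<Rightarrow> ('a set \<Rightarrow> 'k) \<Rightarrow> 'a set \<Rightarrow> 'k"
  where "kprod K p f g Q = (\<Oplus>\<^bsub>K\<^esub>P\<in>nsets Q p. f P \<otimes>\<^bsub>K\<^esub> g (Q - P))"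

definition supp :: "('k, 'm) ring_scheme \<Rightarrow> 'a set \<Rightarrow> nat \<Rightarrow> ('a set \<Rightarrow> 'k) \<Rightarrow> 'a set set"
  where "supp K E p f = {P \<in> nsets E p. f P \<noteq> \<zero>\<^bsub>K\<^esub>}"

definition transversal :: "'a set set \<Rightarrow> 'a set \<Rightarrow> bool"
  where "transversal H T \<longleftrightarrow> (\<forall>A\<in>H. T \<inter> A \<noteq> {})"

text \<open>The value is \<open>\<infinity>\<close> exactly if there is no finite transversal.\<close>

definition transversal_number :: "'a set set \<Rightarrow> enat"
  where "transversal_number H = Inf {enat (card T) | T. finite T \<and> transversal H T}"

definition char_zero_field :: "('k, 'm) ring_scheme \<Rightarrow> bool"
  where "char_zero_field K \<longleftrightarrow>
    field K \<and> (\<forall>n::nat. n > 0 \<longrightarrow> [n] \<cdot>\<^bsub>K\<^esub> \<one>\<^bsub>K\<^esub> \<noteq> \<zero>\<^bsub>K\<^esub>)"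

definition tau_bound :: "'a itself \<Rightarrow> 'k itself \<Rightarrow> nat \<Rightarrow> nat \<Rightarrow> nat \<Rightarrow> bool"
  where "tau_bound _ _ p q t \<longleftrightarrow>
    (\<forall>(E :: 'a set) (K :: 'k ring) f g.
       (infinite E \<or> p + q \<le> card E) \<longrightarrow> char_zero_field K \<longrightarrow>
       f \<in> nsets E p \<rightarrow> carrier K \<longrightarrow> g \<in> nsets E q \<rightarrow> carrier K \<longrightarrow>
       (\<forall>Q\<in>nsets E (p + q). kprod K p f g Q = \<zero>\<^bsub>K\<^esub>) \<longrightarrow>
       (\<exists>P\<in>nsets E p. f P \<noteq> \<zero>\<^bsub>K\<^esub>) \<longrightarrow> (\<exists>P\<in>nsets E q. g P \<noteq> \<zero>\<^bsub>K\<^esub>) \<longrightarrow>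
       transversal_number (supp K E p f \<union> supp K E q g) \<le> enat t)"

text \<open>
  HOL cannot quantify over types inside a term, so the two type arguments are the universes
  from which the ground sets \<open>E\<close> and the carriers of the fields \<open>K\<close> are drawn. The least bound
  is taken in \<^typ>\<open>enat\<close>: the value is \<open>\<infinity>\<close> if there is no bound, and a finite value is the minimum.
\<close>

definition tau :: "'a itself \<Rightarrow> 'k itself \<Rightarrow> nat \<Rightarrow> nat \<Rightarrow> enat"
  where "tau A F p q = Inf {enat t | t. tau_bound A F p q t}"

end

theory Submission
  imports Defs
begin

text \<open>
  The support \<open>S\<close> of \<open>f\<close> is itself a transversal: if \<open>g P \<noteq> 0\<close> with \<open>P\<close> disjoint from \<open>S\<close> and
  \<open>x \<in> S\<close>, then \<open>f x \<cdot> g P\<close> is the only nonzero term of \<open>(f g) (P \<union> {x})\<close>. It has at most \<open>2 n\<close>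
  elements: if \<open>f\<close> is nonzero at more than \<open>2 n\<close> points, then \<open>f g = 0\<close> forces \<open>g = 0\<close>, by
  induction on \<open>n\<close>. For \<open>x, y \<in> S\<close> the map \<open>P \<mapsto> f y \<cdot> g (P \<union> {x}) - f x \<cdot> g (P \<union> {y})\<close> on
  \<open>E - {x, y}\<close> is again annihilated by \<open>f\<close>, so it vanishes; inserting this exchange law into
  \<open>(f g) (P \<union> {x}) = 0\<close> gives \<open>(1 + card (P \<inter> S)) \<cdot> f x \<cdot> g P = 0\<close>.
  The bound is attained on \<open>n\<close> disjoint pairs \<open>{a i, b i}\<close> by \<open>f = \<Sum>i. (a i + b i)\<close> and
  \<open>g = \<Prod>i. (a i - b i)\<close>.
\<close>

section \<open>Finite sums and products with a map on points\<close>

lemma nsets_1_eq: "nsets Q 1 = (\<lambda>x. {x}) ` Q"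
  by (simp add: nsets_one)

lemma (in abelian_monoid) finsum_neutral:
  assumes "\<And>x. x \<in> A \<Longrightarrow> h x = \<zero>"
  shows "(\<Oplus>x\<in>A. h x) = \<zero>"
proof -
  have "(\<Oplus>x\<in>A. h x) = (\<Oplus>x\<in>A. \<zero>)"
    using assms by (intro finsum_cong') auto
  then show ?thesis by simp
qed

lemma (in abelian_monoid) finsum_if_const:
  assumes "finite A" "c \<in> carrier G"
  shows "(\<Oplus>x\<in>A. if p x then c else \<zero>) = [card {x\<in>A. p x}] \<cdot> c"
  using assms(1)
proof (induction A rule: finite_induct)
  case empty
  then show ?case by simp
next
  case (insert x A)
  have eq: "{y \<in> insert x A. p y} = (if p x then insert x {y\<in>A. p y} else {y\<in>A. p y})"
    by auto
  have "card {y \<in> insert x A. p y} =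
      (if p x then Suc (card {y\<in>A. p y}) else card {y\<in>A. p y})"
    unfolding eq using insert.hyps by simp
  then show ?case
    using insert assms(2) by (simp add: a_comm)
qed

lemma (in cring) kprod_1_eq:
  assumes "finite Q" "\<And>x. x \<in> Q \<Longrightarrow> f {x} \<in> carrier R"
    "\<And>x. x \<in> Q \<Longrightarrow> g (Q - {x}) \<in> carrier R"
  shows "kprod R 1 f g Q = (\<Oplus>x\<in>Q. f {x} \<otimes> g (Q - {x}))"
  unfolding kprod_def nsets_1_eq
  using assms by (subst finsum_reindex) (auto simp: inj_on_def Pi_def)

text \<open>Singles out the one term whose \<open>g\<close>-argument avoids the added point
  \<open>x\<close>. Every other argument becomes \<open>insert x (P - {z})\<close>, the form that an
  exchange of \<open>x\<close> and \<open>z\<close> can act on.\<close>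

lemma (in cring) finsum_insert_remove:
  assumes "finite P" "x \<notin> P" "f \<in> insert x P \<rightarrow> carrier R"
    "\<And>z. z \<in> insert x P \<Longrightarrow> g (insert x P - {z}) \<in> carrier R"
  shows "(\<Oplus>z\<in>insert x P. f z \<otimes> g (insert x P - {z})) =
    f x \<otimes> g P \<oplus> (\<Oplus>z\<in>P. f z \<otimes> g (insert x (P - {z})))"
proof -
  have eq: "insert x P - {z} = insert x (P - {z})" if "z \<in> P" for z
    using that assms(2) by auto
  have "g P \<in> carrier R"
    using assms(4)[of x] assms(2) by simp
  moreover have "g (insert x (P - {z})) \<in> carrier R" if "z \<in> P" for z
    using assms(4)[of z] that eq by simp
  moreover have "(\<Oplus>z\<in>P. f z \<otimes> g (insert x P - {z})) = (\<Oplus>z\<in>P. f z \<otimes> g (insert x (P - {z})))"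
    using assms calculation by (intro finsum_cong') (auto simp: eq)
  ultimately show ?thesis
    using assms by (subst finsum_insert) (auto simp: eq)
qed

section \<open>Maps annihilated by a map with many nonzero values\<close>

text \<open>The relations for \<open>insert x Q\<close> and \<open>insert y Q\<close> share the
  value \<open>g Q\<close>. Multiplying the first by \<open>f y\<close>, the second by
  \<open>f x\<close> and subtracting eliminates it. What remains is a relation for a map on
  \<open>n\<close>-sets, which makes induction on the degree possible.\<close>

lemma (in cring) annihilated_exchange:
  assumes f: "f \<in> E \<rightarrow> carrier R" and g: "g \<in> nsets E (Suc n) \<rightarrow> carrier R"
    and zero: "\<And>Q. Q \<in> nsets E (Suc (Suc n)) \<Longrightarrow> (\<Oplus>z\<in>Q. f z \<otimes> g (Q - {z})) = \<zero>"
    and x: "x \<in> E" and y: "y \<in> E" and Q: "Q \<in> nsets (E - {x, y}) (Suc n)"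
  shows "(\<Oplus>z\<in>Q. f z \<otimes> (f y \<otimes> g (insert x (Q - {z})) \<ominus> f x \<otimes> g (insert y (Q - {z})))) = \<zero>"
proof -
  have fin: "finite Q" and QE: "Q \<subseteq> E - {x, y}" and card: "card Q = Suc n"
    using Q by (auto simp: nsets_def)
  have fz: "f z \<in> carrier R" if "z \<in> E" for z
    using f that by auto
  have gQ: "g Q \<in> carrier R"
    using g QE fin card by (auto simp: nsets_def Pi_def)
  have gi: "g (insert u (Q - {z})) \<in> carrier R" if "u \<in> {x, y}" "z \<in> Q" for u z
  proof -
    have "insert u (Q - {z}) \<in> nsets E (Suc n)"
      using that QE fin card x y by (auto simp: nsets_def card_insert_if)
    then show ?thesis using g by auto
  qed
  \<comment> \<open>The terms of the relation for \<open>insert u Q\<close> in which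
    \<open>u\<close> stays in the argument of \<open>g\<close>; the remaining term is
    \<open>f u\<close> times \<open>g Q\<close>.\<close>
  define s where "s u = (\<Oplus>z\<in>Q. f z \<otimes> g (insert u (Q - {z})))" for u
  have s: "s u \<in> carrier R" if "u \<in> {x, y}" for u
    unfolding s_def using that gi fz QE by (intro finsum_closed) auto
  have split: "f u \<otimes> g Q \<oplus> s u = \<zero>" if u: "u \<in> {x, y}" for u
  proof -
    have uQ: "u \<notin> Q" using u QE by auto
    have "(\<Oplus>z\<in>insert u Q. f z \<otimes> g (insert u Q - {z})) = f u \<otimes> g Q \<oplus> s u"
      unfolding s_def
    proof (rule finsum_insert_remove)
      fix z assume "z \<in> insert u Q"
      then have "insert u Q - {z} \<in> nsets E (Suc n)"
        using u uQ QE fin card x y by (auto simp: nsets_def)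
      then show "g (insert u Q - {z}) \<in> carrier R" using g by auto
    qed (use fin uQ u x y QE f in auto)
    moreover have "insert u Q \<in> nsets E (Suc (Suc n))"
      using u uQ QE fin card x y by (auto simp: nsets_def)
    ultimately show ?thesis using zero by metis
  qed
  have s_eq: "s u = \<ominus> (f u \<otimes> g Q)" if "u \<in> {x, y}" for u
    using split[OF that] s[OF that] gQ fz[of u] that x y
    by (metis (no_types, lifting) insertE m_closed minus_equality a_comm singletonD)
  have smul: "(\<Oplus>z\<in>Q. c \<otimes> (f z \<otimes> g (insert u (Q - {z})))) = c \<otimes> s u"
    if "u \<in> {x, y}" "c \<in> carrier R" for u c
    unfolding s_def using that gi fz QE fin by (subst finsum_rdistr) auto
  have "(\<Oplus>z\<in>Q. f z \<otimes> (f y \<otimes> g (insert x (Q - {z})) \<ominus> f x \<otimes> g (insert y (Q - {z})))) =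
    (\<Oplus>z\<in>Q. f y \<otimes> (f z \<otimes> g (insert x (Q - {z}))) \<oplus> (\<ominus> f x) \<otimes> (f z \<otimes> g (insert y (Q - {z}))))"
  proof (rule finsum_cong')
    fix z assume "z \<in> Q"
    then have "f z \<in> carrier R" "f x \<in> carrier R" "f y \<in> carrier R"
        "g (insert x (Q - {z})) \<in> carrier R" "g (insert y (Q - {z})) \<in> carrier R"
      using gi fz QE x y by auto
    then show "f z \<otimes> (f y \<otimes> g (insert x (Q - {z})) \<ominus> f x \<otimes> g (insert y (Q - {z}))) =
      f y \<otimes> (f z \<otimes> g (insert x (Q - {z}))) \<oplus> (\<ominus> f x) \<otimes> (f z \<otimes> g (insert y (Q - {z})))"
      by (simp add: minus_eq r_distr l_minus r_minus m_lcomm)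
  qed (use gi fz QE x y in auto)
  also have "\<dots> = f y \<otimes> s x \<oplus> (\<ominus> f x) \<otimes> s y"
    using gi fz QE x y by (subst finsum_addf) (auto simp: smul)
  also have "\<dots> = \<zero>"
    using gQ fz x y by (simp add: s_eq l_minus r_minus m_lcomm l_neg)
  finally show ?thesis .
qed

text \<open>An exchange lowers the degree by one and costs at most two points of \<open>S\<close>,
  so \<open>2 * n < card S\<close> survives the induction. Both \<open>E\<close> and
  \<open>S\<close> shrink and \<open>g\<close> changes, hence the generalisation over them.\<close>

lemma (in field) zero_if_annihilated:
  assumes char: "\<And>k::nat. k > 0 \<Longrightarrow> [k] \<cdot> \<one> \<noteq> \<zero>"
  assumes "f \<in> E \<rightarrow> carrier R" "g \<in> nsets E n \<rightarrow> carrier R"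
    and "\<And>Q. Q \<in> nsets E (Suc n) \<Longrightarrow> (\<Oplus>z\<in>Q. f z \<otimes> g (Q - {z})) = \<zero>"
    and "S \<subseteq> E" "finite S" "2 * n < card S" "\<And>x. x \<in> S \<Longrightarrow> f x \<noteq> \<zero>"
    and "P \<in> nsets E n"
  shows "g P = \<zero>"
  using assms(2-)
proof (induction n arbitrary: E g S P)
  case 0
  from 0 obtain x where x: "x \<in> S" by fastforce
  have P: "P = {}" and xE: "x \<in> E" and g: "g {} \<in> carrier R" and fx: "f x \<in> carrier R"
    using 0 x by (auto simp: nsets_def Pi_def)
  \<comment> \<open>In degree zero the relation for \<open>{x}\<close> is the single term
    \<open>f x\<close> times \<open>g {}\<close>.\<close>
  have "(\<Oplus>z\<in>{x}. f z \<otimes> g ({x} - {z})) = \<zero>"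
    using xE by (intro 0(3)) (auto simp: nsets_def)
  then have "f x \<otimes> g {} = \<zero>"
    using g fx by (subst (asm) finsum_insert) auto
  then show ?case
    using P x 0 g fx integral by blast
next
  case (Suc n)
  note f = Suc.prems(1) and g = Suc.prems(2) and zero = Suc.prems(3)
  have fin: "finite P" and PE: "P \<subseteq> E" and card: "card P = Suc n"
    using Suc.prems by (auto simp: nsets_def)
  have fz: "f z \<in> carrier R" if "z \<in> E" for z
    using f that by auto
  have gP: "g P \<in> carrier R"
    using g Suc.prems by auto
  \<comment> \<open>The law covers all points of \<open>E\<close>, zeros of \<open>f\<close>
    included: below, one of the two exchanged points is an arbitrary element of
    \<open>P\<close>.\<close>
  have exch: "f y \<otimes> g (insert x A) = f x \<otimes> g (insert y A)"
    if x: "x \<in> E" and y: "y \<in> E" and A: "A \<in> nsets (E - {x, y}) n" for x y A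
  proof -
    have gi: "g (insert u B) \<in> carrier R" if "u \<in> {x, y}" "B \<in> nsets (E - {x, y}) n" for u B
    proof -
      have "insert u B \<in> nsets E (Suc n)"
        using that x y by (auto simp: nsets_def card_insert_if)
      then show ?thesis using g by auto
    qed
    have "card S - card {x, y} \<le> card (S - {x, y})"
      by (intro diff_card_le_card_Diff) simp
    moreover have "card {x, y} \<le> 2"
      by (simp add: card_insert_if)
    ultimately have cS: "2 * n < card (S - {x, y})"
      using Suc.prems(6) by simp
    have "f y \<otimes> g (insert x A) \<ominus> f x \<otimes> g (insert y A) = \<zero>"
    proof (rule Suc.IH[where E = "E - {x, y}" and S = "S - {x, y}" and
        g = "\<lambda>B. f y \<otimes> g (insert x B) \<ominus> f x \<otimes> g (insert y B)"])
      show "f \<in> E - {x, y} \<rightarrow> carrier R"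
        using f by auto
      show "(\<lambda>B. f y \<otimes> g (insert x B) \<ominus> f x \<otimes> g (insert y B)) \<in> nsets (E - {x, y}) n \<rightarrow> carrier R"
        using gi fz x y by auto
      show "\<And>Q. Q \<in> nsets (E - {x, y}) (Suc n) \<Longrightarrow>
        (\<Oplus>z\<in>Q. f z \<otimes> (f y \<otimes> g (insert x (Q - {z})) \<ominus> f x \<otimes> g (insert y (Q - {z})))) = \<zero>"
        using annihilated_exchange[OF f g zero x y] by blast
    qed (use Suc.prems cS A in auto)
    moreover have "f y \<otimes> g (insert x A) \<in> carrier R" "f x \<otimes> g (insert y A) \<in> carrier R"
      using gi fz x y A by auto
    ultimately show ?thesis
      by (metis minus_eq minus_equality minus_minus a_inv_closed)
  qed
  have "card P < card S"
    using card Suc.prems(6) by simp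
  then obtain x where x: "x \<in> S" "x \<notin> P"
    using card_mono[OF fin, of S] by fastforce
  then have xE: "x \<in> E" and fx: "f x \<noteq> \<zero>" and fxc: "f x \<in> carrier R"
    using Suc.prems fz by auto
  define c where "c = f x \<otimes> g P"
  define k where "k = card {z\<in>P. f z \<noteq> \<zero>}"
  have c: "c \<in> carrier R"
    using gP fxc by (simp add: c_def)
  have gx: "g (insert x P - {z}) \<in> carrier R" if "z \<in> insert x P" for z
  proof -
    have "insert x P - {z} \<in> nsets E (Suc n)"
      using that x xE PE fin card by (auto simp: nsets_def)
    then show ?thesis using g by auto
  qed
  \<comment> \<open>Exchanging \<open>x\<close> and \<open>z\<close> restores \<open>P\<close> as
    the argument of \<open>g\<close>, so a term with \<open>f z\<close> nonzero equals
    \<open>c\<close>; in the others the factor \<open>f z\<close> vanishes.\<close>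
  have term_eq: "f z \<otimes> g (insert x (P - {z})) = (if f z \<noteq> \<zero> then c else \<zero>)" if z: "z \<in> P" for z
  proof -
    have ex: "f z \<otimes> g (insert x (P - {z})) = f x \<otimes> g (insert z (P - {z}))"
      using z x xE PE fin card by (intro exch) (auto simp: nsets_def)
    have "insert x (P - {z}) = insert x P - {z}"
      using z x by auto
    then have "g (insert x (P - {z})) \<in> carrier R"
      using gx z by simp
    then show ?thesis
      using ex z by (auto simp: c_def insert_absorb)
  qed
  have "insert x P \<in> nsets E (Suc (Suc n))"
    using x xE PE fin card by (auto simp: nsets_def)
  then have "\<zero> = (\<Oplus>z\<in>insert x P. f z \<otimes> g (insert x P - {z}))"
    using zero by simp
  also have "\<dots> = c \<oplus> (\<Oplus>z\<in>P. f z \<otimes> g (insert x (P - {z})))"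
    unfolding c_def using fin x xE PE f gx by (intro finsum_insert_remove) auto
  also have "(\<Oplus>z\<in>P. f z \<otimes> g (insert x (P - {z}))) = (\<Oplus>z\<in>P. if f z \<noteq> \<zero> then c else \<zero>)"
    using c by (intro finsum_cong') (auto simp: term_eq)
  also have "\<dots> = [k] \<cdot> c"
    unfolding k_def using fin c by (rule finsum_if_const)
  \<comment> \<open>The term of \<open>x\<close> itself raises the count to \<open>Suc k\<close>,
    which is positive even if \<open>f\<close> vanishes on all of \<open>P\<close>. Characteristic
    zero then allows division by it.\<close>
  also have "c \<oplus> [k] \<cdot> c = [Suc k] \<cdot> c"
    using c by (simp add: a_comm)
  also have "\<dots> = ([Suc k] \<cdot> \<one>) \<otimes> c"
    using c add_pow_ldistr[of \<one> c "Suc k"] by simp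
  finally have "([Suc k] \<cdot> \<one>) \<otimes> c = \<zero>" by simp
  then have "c = \<zero>"
    using char[of "Suc k"] c integral[of "[Suc k] \<cdot> \<one>" c] by blast
  then show ?case
    using fx fxc gP integral by (auto simp: c_def)
qed

section \<open>The upper bound\<close>

lemma tau_bound_1: "tau_bound TYPE('a) TYPE('k) 1 n (2 * n)"
  unfolding tau_bound_def
proof (intro allI impI)
  fix E :: "'a set" and K :: "'k ring" and f g
  assume K: "char_zero_field K"
    and f: "f \<in> nsets E 1 \<rightarrow> carrier K" and g: "g \<in> nsets E n \<rightarrow> carrier K"
    and zero: "\<forall>Q\<in>nsets E (1 + n). kprod K 1 f g Q = \<zero>\<^bsub>K\<^esub>"
    and f0: "\<exists>P\<in>nsets E 1. f P \<noteq> \<zero>\<^bsub>K\<^esub>" and g0: "\<exists>P\<in>nsets E n. g P \<noteq> \<zero>\<^bsub>K\<^esub>"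
  interpret K: field K
    using K by (simp add: char_zero_field_def)
  define \<phi> where "\<phi> x = f {x}" for x
  have \<phi>: "\<phi> \<in> E \<rightarrow> carrier K"
    using f unfolding nsets_1_eq \<phi>_def by auto
  have gQ: "g (Q - {x}) \<in> carrier K" if "Q \<in> nsets E (Suc n)" "x \<in> Q" for Q x
  proof -
    have "Q - {x} \<in> nsets E n"
      using that by (auto simp: nsets_def)
    then show ?thesis using g by auto
  qed
  have ann: "(\<Oplus>\<^bsub>K\<^esub>z\<in>Q. \<phi> z \<otimes>\<^bsub>K\<^esub> g (Q - {z})) = \<zero>\<^bsub>K\<^esub>" if Q: "Q \<in> nsets E (Suc n)" for Q
  proof -
    have "kprod K 1 f g Q = (\<Oplus>\<^bsub>K\<^esub>z\<in>Q. \<phi> z \<otimes>\<^bsub>K\<^esub> g (Q - {z}))"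
      unfolding \<phi>_def
    proof (rule K.kprod_1_eq)
      show "f {x} \<in> carrier K" if "x \<in> Q" for x
        using that Q \<phi> unfolding \<phi>_def by (auto simp: nsets_def)
    qed (use Q gQ in \<open>auto simp: nsets_def\<close>)
    then show ?thesis using zero Q by simp
  qed
  define S where "S = {x\<in>E. \<phi> x \<noteq> \<zero>\<^bsub>K\<^esub>}"
  \<comment> \<open>Phrased for finite subsets because \<open>E\<close> may be infinite and
    \<open>S\<close> is not yet known to be finite; finiteness is derived from this bound.\<close>
  have small: "\<not> 2 * n < card S'" if "S' \<subseteq> S" "finite S'" for S'
  proof
    assume large: "2 * n < card S'"
    have char: "[k] \<cdot>\<^bsub>K\<^esub> \<one>\<^bsub>K\<^esub> \<noteq> \<zero>\<^bsub>K\<^esub>" if "k > 0" for k :: nat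
      using K that by (simp add: char_zero_field_def)
    have "S' \<subseteq> E" "\<And>x. x \<in> S' \<Longrightarrow> \<phi> x \<noteq> \<zero>\<^bsub>K\<^esub>"
      using \<open>S' \<subseteq> S\<close> by (auto simp: S_def)
    then have "g P = \<zero>\<^bsub>K\<^esub>" if "P \<in> nsets E n" for P
      using K.zero_if_annihilated[OF char \<phi> g ann _ \<open>finite S'\<close> large _ that] by blast
    then show False using g0 by blast
  qed
  have finS: "finite S"
  proof (rule ccontr)
    assume "infinite S"
    then obtain S' where "finite S'" "card S' = Suc (2 * n)" "S' \<subseteq> S"
      using infinite_arbitrarily_large by blast
    then show False using small[of S'] by simp
  qed
  have "transversal (supp K E 1 f \<union> supp K E n g) S"
    unfolding transversal_def
  proof
    fix A assume "A \<in> supp K E 1 f \<union> supp K E n g"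
    then show "S \<inter> A \<noteq> {}"
    proof
      assume "A \<in> supp K E 1 f"
      then show ?thesis
        unfolding supp_def nsets_1_eq S_def \<phi>_def by auto
    next
      assume A: "A \<in> supp K E n g"
      then have fin: "finite A" and AE: "A \<subseteq> E" and card: "card A = n"
        and gA: "g A \<noteq> \<zero>\<^bsub>K\<^esub>" "g A \<in> carrier K"
        using g by (auto simp: supp_def nsets_def Pi_def)
      obtain x where x: "x \<in> E" "\<phi> x \<noteq> \<zero>\<^bsub>K\<^esub>"
        using f0 unfolding nsets_1_eq \<phi>_def by auto
      show ?thesis
      proof
        assume disj: "S \<inter> A = {}"
        then have xA: "x \<notin> A" and z0: "\<And>z. z \<in> A \<Longrightarrow> \<phi> z = \<zero>\<^bsub>K\<^esub>"
          using x AE by (auto simp: S_def)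
        \<comment> \<open>Test set for the contradiction: \<open>x\<close> is its only point at
          which \<open>\<phi>\<close> is nonzero, so the relation reduces to \<open>\<phi> x\<close>
          times \<open>g A\<close>.\<close>
        have Q: "insert x A \<in> nsets E (Suc n)"
          using x xA fin AE card by (auto simp: nsets_def)
        have gz: "g (insert x (A - {z})) \<in> carrier K" if "z \<in> A" for z
        proof -
          have "insert x (A - {z}) = insert x A - {z}"
            using that xA by auto
          then show ?thesis using gQ[OF Q, of z] that by simp
        qed
        have "\<zero>\<^bsub>K\<^esub> = (\<Oplus>\<^bsub>K\<^esub>z\<in>insert x A. \<phi> z \<otimes>\<^bsub>K\<^esub> g (insert x A - {z}))"
          using ann[OF Q] by simp
        also have "\<dots> = \<phi> x \<otimes>\<^bsub>K\<^esub> g A \<oplus>\<^bsub>K\<^esub> (\<Oplus>\<^bsub>K\<^esub>z\<in>A. \<phi> z \<otimes>\<^bsub>K\<^esub> g (insert x (A - {z})))"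
          using fin xA \<phi> x AE gQ[OF Q] by (intro K.finsum_insert_remove) auto
        also have "(\<Oplus>\<^bsub>K\<^esub>z\<in>A. \<phi> z \<otimes>\<^bsub>K\<^esub> g (insert x (A - {z}))) = \<zero>\<^bsub>K\<^esub>"
          using gz by (intro K.finsum_neutral) (auto simp: z0)
        finally have "\<phi> x \<otimes>\<^bsub>K\<^esub> g A = \<zero>\<^bsub>K\<^esub>"
          using K.m_closed[of "\<phi> x" "g A"] K.r_zero \<phi> x gA by fastforce
        then show False
          using K.integral[of "\<phi> x" "g A"] \<phi> x gA by auto
      qed
    qed
  qed
  then have "transversal_number (supp K E 1 f \<union> supp K E n g) \<le> enat (card S)"
    unfolding transversal_number_def using finS by (intro Inf_lower) auto
  also have "\<dots> \<le> enat (2 * n)"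
    using small[OF subset_refl finS] by simp
  finally show "transversal_number (supp K E 1 f \<union> supp K E n g) \<le> enat (2 * n)" .
qed

section \<open>Fields of characteristic zero on an infinite type\<close>

text \<open>An infinite type contains a copy of the countable set of rationals, and the field
  structure is transported along the injection \<open>h\<close>. The carrier is only the range of
  \<open>h\<close>, so no bijection with the whole type is required.\<close>

lemma char_zero_field_exists:
  assumes "infinite (UNIV :: 'k set)"
  shows "\<exists>K :: 'k ring. char_zero_field K"
proof -
  obtain u :: "nat \<Rightarrow> 'k" where "inj u"
    using assms infinite_countable_subset by blast
  then have "inj (u \<circ> (to_nat :: rat \<Rightarrow> nat))"
    by (intro inj_compose) auto
  then obtain h :: "rat \<Rightarrow> 'k" where h: "inj h" by blast
  define d where "d = the_inv h"
  have d [simp]: "d (h r) = r" for r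
    using h by (simp add: d_def the_inv_f_f)
  define K :: "'k ring" where
    "K = \<lparr>carrier = range h, mult = \<lambda>x y. h (d x * d y), one = h 1, zero = h 0,
      add = \<lambda>x y. h (d x + d y)\<rparr>"
  have h_eq [simp]: "h r = h s \<longleftrightarrow> r = s" for r s
    using h by (auto simp: inj_def)
  have "cring K"
  proof (rule cringI)
    show "abelian_group K"
    proof (rule abelian_groupI)
      fix x assume "x \<in> carrier K"
      then show "\<exists>y\<in>carrier K. y \<oplus>\<^bsub>K\<^esub> x = \<zero>\<^bsub>K\<^esub>"
        by (intro bexI[of _ "h (- d x)"]) (auto simp: K_def)
    qed (auto simp: K_def algebra_simps)
    show "comm_monoid K"
      by (rule comm_monoidI) (auto simp: K_def algebra_simps)
  qed (auto simp: K_def algebra_simps)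
  then interpret K: cring K .
  have "field K"
  proof (rule K.cring_fieldI2)
    show "\<zero>\<^bsub>K\<^esub> \<noteq> \<one>\<^bsub>K\<^esub>" by (simp add: K_def)
    fix x assume "x \<in> carrier K" "x \<noteq> \<zero>\<^bsub>K\<^esub>"
    then show "\<exists>y\<in>carrier K. x \<otimes>\<^bsub>K\<^esub> y = \<one>\<^bsub>K\<^esub>"
      by (intro bexI[of _ "h (inverse (d x))"]) (auto simp: K_def)
  qed
  have ops: "\<zero>\<^bsub>K\<^esub> = h 0" "\<one>\<^bsub>K\<^esub> = h 1" "h r \<oplus>\<^bsub>K\<^esub> h s = h (r + s)" for r s
    by (simp_all add: K_def)
  have "[m] \<cdot>\<^bsub>K\<^esub> \<one>\<^bsub>K\<^esub> = h (of_nat m)" for m :: nat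
    by (induction m) (simp_all add: ops add.commute)
  then have "[m] \<cdot>\<^bsub>K\<^esub> \<one>\<^bsub>K\<^esub> \<noteq> \<zero>\<^bsub>K\<^esub>" if "m > 0" for m :: nat
    using that by (simp add: ops)
  with \<open>field K\<close> show ?thesis
    unfolding char_zero_field_def by blast
qed

section \<open>The extremal example\<close>

text \<open>These sets are the monomials in the expansion of the product of the
  \<open>a i - b i\<close>: one point is chosen from each pair.\<close>

definition choice_set :: "nat \<Rightarrow> (nat \<Rightarrow> 'a) \<Rightarrow> (nat \<Rightarrow> 'a) \<Rightarrow> 'a set \<Rightarrow> bool"
  where "choice_set n a b P \<longleftrightarrow>
    P \<subseteq> a ` {..<n} \<union> b ` {..<n} \<and> (\<forall>i<n. a i \<in> P \<longleftrightarrow> b i \<notin> P)"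

text \<open>The coefficient of \<open>P\<close> in \<open>\<Prod>i<n. (a i - b i)\<close>.\<close>

definition pair_product ::
  "('k, 'm) ring_scheme \<Rightarrow> nat \<Rightarrow> (nat \<Rightarrow> 'a) \<Rightarrow> (nat \<Rightarrow> 'a) \<Rightarrow> 'a set \<Rightarrow> 'k"
  where "pair_product K n a b P =
    (if choice_set n a b P
     then if even (card (P \<inter> b ` {..<n})) then \<one>\<^bsub>K\<^esub> else \<ominus>\<^bsub>K\<^esub> \<one>\<^bsub>K\<^esub> else \<zero>\<^bsub>K\<^esub>)"

lemma (in ring) pair_product_closed [simp]: "pair_product R n a b P \<in> carrier R"
  by (simp add: pair_product_def)

text \<open>A nonzero term forces \<open>Q\<close> to contain exactly one full pair and one point of
  every other pair. Only the removal of \<open>a i\<close> or of \<open>b i\<close> from the full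
  pair leaves a choice set, and these two terms have opposite signs.\<close>

lemma (in ring) pair_product_sum_eq_zero:
  assumes ab: "inj_on a {..<n}" "inj_on b {..<n}" "a ` {..<n} \<inter> b ` {..<n} = {}"
    and Q_sub: "Q \<subseteq> a ` {..<n} \<union> b ` {..<n}"
  shows "(\<Oplus>z\<in>Q. pair_product R n a b (Q - {z})) = \<zero>"
proof (cases "\<exists>x\<in>Q. choice_set n a b (Q - {x})")
  case False
  then show ?thesis
    by (intro finsum_neutral) (auto simp: pair_product_def)
next
  case True
  then obtain x0 where x0: "x0 \<in> Q" "choice_set n a b (Q - {x0})" by blast
  let ?E = "a ` {..<n} \<union> b ` {..<n}"
  obtain i where i: "i < n" "x0 = a i \<or> x0 = b i"
    using x0(1) Q_sub by auto
  have neq: "a i \<noteq> b i" and aB: "a i \<notin> b ` {..<n}" and bB: "b i \<in> b ` {..<n}"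
    using ab i by auto
  have finQ: "finite Q"
    using finite_subset[OF Q_sub] by simp
  have ch: "j < n \<Longrightarrow> a j \<in> Q - {x0} \<longleftrightarrow> b j \<notin> Q - {x0}" for j
    using x0 by (auto simp: choice_set_def)
  \<comment> \<open>\<open>Q - {x0}\<close> contains exactly one point of the pair, and
    \<open>x0\<close> is the other one.\<close>
  have inQ: "a i \<in> Q" "b i \<in> Q"
    using ch[of i] i x0(1) neq by auto
  define R' where "R' = Q - {a i, b i}"
  have finR: "finite R'" and abR: "a i \<notin> R'" "b i \<notin> R'" and Q: "Q = insert (a i) (insert (b i) R')"
    using finQ inQ by (auto simp: R'_def)
  have RE: "R' \<subseteq> ?E"
    using Q_sub by (auto simp: R'_def)
  have chR: "a j \<in> R' \<longleftrightarrow> b j \<notin> R'" if j: "j < n" "j \<noteq> i" for j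
  proof -
    have "a j \<noteq> a i" "b j \<noteq> b i" "a j \<noteq> b i" "b j \<noteq> a i"
      using j i ab by (auto simp: inj_on_def)
    then show ?thesis
      using ch[of j] j i by (auto simp: R'_def)
  qed
  \<comment> \<open>Removing a point outside the full pair leaves both \<open>a i\<close> and
    \<open>b i\<close> in the set.\<close>
  have other: "pair_product R n a b (Q - {z}) = \<zero>" if "z \<in> R'" for z
  proof -
    have "\<not> choice_set n a b (Q - {z})"
      using that i abR inQ by (auto simp: choice_set_def)
    then show ?thesis by (simp add: pair_product_def)
  qed
  have Qa: "Q - {a i} = insert (b i) R'" and Qb: "Q - {b i} = insert (a i) R'"
    using Q abR neq by auto
  have chb: "choice_set n a b (insert (b i) R')" and cha: "choice_set n a b (insert (a i) R')"
  proof -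
    have "a j \<in> insert (b i) R' \<longleftrightarrow> b j \<notin> insert (b i) R'"
      and "a j \<in> insert (a i) R' \<longleftrightarrow> b j \<notin> insert (a i) R'" if "j < n" for j
      using chR[of j] that ab i abR neq by (cases "j = i"; auto simp: inj_on_def)+
    then show "choice_set n a b (insert (b i) R')" "choice_set n a b (insert (a i) R')"
      using RE i by (auto simp: choice_set_def)
  qed
  \<comment> \<open>The sign counts the chosen \<open>b\<close>-points, so keeping
    \<open>b i\<close> instead of \<open>a i\<close> changes its parity.\<close>
  have "insert (b i) R' \<inter> b ` {..<n} = insert (b i) (R' \<inter> b ` {..<n})"
    and "insert (a i) R' \<inter> b ` {..<n} = R' \<inter> b ` {..<n}"
    using aB bB by auto
  moreover have "card (insert (b i) (R' \<inter> b ` {..<n})) = Suc (card (R' \<inter> b ` {..<n}))"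
    using finR abR by simp
  ultimately have cancel:
    "pair_product R n a b (Q - {a i}) \<oplus> pair_product R n a b (Q - {b i}) = \<zero>"
    unfolding Qa Qb by (simp add: pair_product_def cha chb l_neg r_neg)
  have "(\<Oplus>z\<in>Q. pair_product R n a b (Q - {z})) =
    (\<Oplus>z\<in>insert (a i) (insert (b i) R'). pair_product R n a b (Q - {z}))"
    using Q by simp
  also have "\<dots> = pair_product R n a b (Q - {a i}) \<oplus> (pair_product R n a b (Q - {b i}) \<oplus>
    (\<Oplus>z\<in>R'. pair_product R n a b (Q - {z})))"
    using finR abR neq by simp
  also have "(\<Oplus>z\<in>R'. pair_product R n a b (Q - {z})) = \<zero>"
    by (intro finsum_neutral other)
  finally show ?thesis
    using cancel by simp
qed

text \<open>With \<open>f\<close> constantly one, every singleton of \<open>E\<close> lies in the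
  support, so a transversal must contain all \<open>2 * n\<close> points.\<close>

lemma tau_bound_1_imp_le:
  assumes "infinite (UNIV :: 'a set)" and "infinite (UNIV :: 'k set)"
    and bound: "tau_bound TYPE('a) TYPE('k) 1 n t"
  shows "2 * n \<le> t"
proof (cases "n = 0")
  case False
  obtain e :: "nat \<Rightarrow> 'a" where e: "inj e"
    using assms(1) infinite_countable_subset by blast
  obtain K :: "'k ring" where K: "char_zero_field K"
    using char_zero_field_exists[OF assms(2)] by blast
  interpret K: field K
    using K by (simp add: char_zero_field_def)
  \<comment> \<open>Even and odd indices along one injective sequence keep all points of the pairs
    distinct.\<close>
  define a where "a i = e (2 * i)" for i
  define b where "b i = e (Suc (2 * i))" for i
  define E where "E = a ` {..<n} \<union> b ` {..<n}"
  have a: "inj_on a {..<n}" and b: "inj_on b {..<n}"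
    by (auto simp: a_def b_def inj_on_def inj_eq[OF e])
  have ab: "a i \<noteq> b j" for i j
  proof -
    have "2 * i \<noteq> Suc (2 * j)" by presburger
    then show ?thesis using inj_eq[OF e] by (simp add: a_def b_def)
  qed
  then have disj: "a ` {..<n} \<inter> b ` {..<n} = {}" by auto
  have finE: "finite E" and cardE: "card E = 2 * n"
    using disj card_image[OF a] card_image[OF b] by (auto simp: E_def card_Un_disjoint)
  let ?f = "\<lambda>_ :: 'a set. \<one>\<^bsub>K\<^esub>" and ?g = "pair_product K n a b"
  let ?H = "supp K E 1 ?f \<union> supp K E n ?g"
  have "kprod K 1 ?f ?g Q = \<zero>\<^bsub>K\<^esub>" if "Q \<in> nsets E (1 + n)" for Q
  proof -
    have "finite Q" "Q \<subseteq> E"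
      using that by (auto simp: nsets_def)
    then have "kprod K 1 ?f ?g Q = (\<Oplus>\<^bsub>K\<^esub>z\<in>Q. ?g (Q - {z}))"
      by (subst K.kprod_1_eq) auto
    also have "\<dots> = \<zero>\<^bsub>K\<^esub>"
      using a b disj \<open>Q \<subseteq> E\<close> unfolding E_def by (rule K.pair_product_sum_eq_zero)
    finally show ?thesis .
  qed
  moreover have "\<exists>P\<in>nsets E 1. ?f P \<noteq> \<zero>\<^bsub>K\<^esub>"
    using False unfolding nsets_1_eq E_def by auto
  moreover have "\<exists>P\<in>nsets E n. ?g P \<noteq> \<zero>\<^bsub>K\<^esub>"
  proof
    \<comment> \<open>The monomial that takes \<open>a i\<close> from every pair contains no
      \<open>b\<close>-point, so its coefficient is one.\<close>
    show "a ` {..<n} \<in> nsets E n"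
      using card_image[OF a] by (auto simp: nsets_def E_def)
    show "?g (a ` {..<n}) \<noteq> \<zero>\<^bsub>K\<^esub>"
      using disj by (auto simp: pair_product_def choice_set_def)
  qed
  \<comment> \<open>This needs \<open>n > 0\<close>, as does the existence of a point at which
    \<open>f\<close> is nonzero; hence the case split.\<close>
  moreover have "1 + n \<le> card E"
    using False cardE by simp
  ultimately have le: "transversal_number ?H \<le> enat t"
    using bound K unfolding tau_bound_def by auto
  have "enat (2 * n) \<le> transversal_number ?H"
    unfolding transversal_number_def
  proof (rule Inf_greatest, clarify)
    fix T assume T: "finite T" "transversal ?H T"
    have "x \<in> T" if "x \<in> E" for x
    proof -
      have "{x} \<in> ?H"
        using that unfolding supp_def nsets_1_eq by auto
      then show ?thesis
        using T(2) unfolding transversal_def by blast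
    qed
    then have "card E \<le> card T"
      using T(1) by (intro card_mono) auto
    then show "enat (2 * n) \<le> enat (card T)"
      by (simp add: cardE)
  qed
  then have "enat (2 * n) \<le> enat t"
    using le by (rule order_trans)
  then show ?thesis by simp
qed simp

text \<open>Infinite universes provide room for the \<open>2 * n\<close> points of the extremal
  example for every \<open>n\<close>, and for a field of characteristic zero.\<close>

theorem theorem14:
  fixes n :: nat
  assumes "infinite (UNIV :: 'a set)" and "infinite (UNIV :: 'k set)"
  shows "tau TYPE('a) TYPE('k) 1 n = enat (2 * n)"
  unfolding tau_def
proof (rule antisym)
  show "Inf {enat t |t. tau_bound TYPE('a) TYPE('k) 1 n t} \<le> enat (2 * n)"
    using tau_bound_1[where ?'a = 'a and ?'k = 'k] by (intro Inf_lower) blast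
  show "enat (2 * n) \<le> Inf {enat t |t. tau_bound TYPE('a) TYPE('k) 1 n t}"
    using tau_bound_1_imp_le[OF assms] by (intro Inf_greatest) auto
qed

end
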